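(* Let $g$ be the odd analytic shock similarity profile, i.e. the unique solution of $$(g g')''=\tfrac13\, z\, g' \ \text{ in } \mathbb{R},\qquad g(-\infty)=1,\quad g(+\infty)=-1,\qquad g(0)=g''(0)=0,$$ with $g(z)>0$ for $z<0$. For $t<0$ set $u_-(x,t)=g\big(x/(-t)^{1/3}\big)$, and let $S_-(x)=-\operatorname{sign}x$. Then the convergence $$u_-(\cdot,t)\to S_-\quad\text{as } t\to0^-$$ (i) does not hold in $L^1(\mathbb{R})$, and (ii) does hold in $L^1_{\rm loc}(\mathbb{R})$.
   Context: Here $'=d/dz$, $g(\pm\infty)=\lim_{z\to\pm\infty}g(z)$, and $\operatorname{sign}0=0$. Convergence in $L^1(\mathbb{R})$ means $\|u_-(\cdot,t)-S_-\|_{L^1(\mathbb{R})}\to0$ as $t\to 0^-$; convergence in $L^1_{\rm loc}(\mathbb{R})$ means $\int_{-l}^{l}|u_-(x,t)-S_-(x)|\,dx\to0$ as $t\to0^-$ for every finite $l>0$. The existence and uniqueness of $g$ with the listed properties may be taken as given. The function $u_-$ is a similarity solution of $u_t=(uu_x)_{xx}$ for $t<0$. *)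

theory Defs
  imports "HOL-Analysis.Analysis"
begin

definition real_analytic :: "(real \<Rightarrow> real) \<Rightarrow> bool" where
  "real_analytic f \<longleftrightarrow>
     (\<forall>x. \<exists>a r. r > 0 \<and> (\<forall>y. \<bar>y - x\<bar> < r \<longrightarrow> (\<lambda>n. a n * (y - x) ^ n) sums f y))"

(* Analyticity makes g infinitely differentiable, so every deriv below is a genuine derivative. *)
definition shock_profile :: "(real \<Rightarrow> real) \<Rightarrow> bool" where
  "shock_profile g \<longleftrightarrow>
     real_analytic g \<and>
     (\<forall>z. g (- z) = - g z) \<and>
     (\<forall>z. deriv (deriv (\<lambda>y. g y * deriv g y)) z = 1 / 3 * z * deriv g z) \<and>
     (g \<longlongrightarrow> 1) at_bot \<and> (g \<longlongrightarrow> - 1) at_top \<and>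
     g 0 = 0 \<and> deriv (deriv g) 0 = 0 \<and>
     (\<forall>z<0. g z > 0)"

definition u_minus :: "(real \<Rightarrow> real) \<Rightarrow> real \<Rightarrow> real \<Rightarrow> real" where
  "u_minus g x t = g (x / (- t) powr (1 / 3))"

definition S_minus :: "real \<Rightarrow> real" where
  "S_minus x = - sgn x"

(* The norm is extended-real valued: it is infinite when a measurable f is not integrable
   (a Bochner integral would give 0 there). *)
definition L1_norm_on :: "real set \<Rightarrow> (real \<Rightarrow> real) \<Rightarrow> ennreal" where
  "L1_norm_on A f = (\<integral>\<^sup>+ x\<in>A. ennreal \<bar>f x\<bar> \<partial>lborel)"

definition tendsto_L1 ::
    "(real \<Rightarrow> real \<Rightarrow> real) \<Rightarrow> (real \<Rightarrow> real) \<Rightarrow> real filter \<Rightarrow> bool" where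
  "tendsto_L1 u S F \<longleftrightarrow> ((\<lambda>t. L1_norm_on UNIV (\<lambda>x. u x t - S x)) \<longlongrightarrow> 0) F"

definition tendsto_L1_loc ::
    "(real \<Rightarrow> real \<Rightarrow> real) \<Rightarrow> (real \<Rightarrow> real) \<Rightarrow> real filter \<Rightarrow> bool" where
  "tendsto_L1_loc u S F \<longleftrightarrow>
     (\<forall>l>0. ((\<lambda>t. L1_norm_on {- l..l} (\<lambda>x. u x t - S x)) \<longlongrightarrow> 0) F)"

end

theory Submission
  imports Defs "HOL-Complex_Analysis.Cauchy_Integral_Formula"
begin

text \<open>
  The substitution \<open>x = (-t)\<^sup>1\<^sup>/\<^sup>3 y\<close> multiplies the \<open>L\<^sup>1\<close> norm of \<open>g + sgn\<close> by \<open>(-t)\<^sup>1\<^sup>/\<^sup>3\<close>. So the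
  global distance tends to zero if \<open>g + sgn\<close> is integrable, and it is infinite at every \<open>t < 0\<close>
  otherwise. On a bounded interval dominated convergence gives the limit zero, because
  \<open>g\<close> is bounded. All the work is therefore to show that \<open>g + sgn\<close> is not integrable
  (\<open>shock_profile_L1_distance_infinite\<close>).

  Write \<open>h = 1 + g\<close> for \<open>z \<rightarrow> \<infinity>\<close>. Linearised at \<open>g = -1\<close>, the profile equation says that \<open>h'\<close> solves an
  Airy equation on its oscillatory side, and so \<open>h\<close> oscillates with an amplitude of order
  \<open>z\<^sup>-\<^sup>3\<^sup>/\<^sup>4\<close>, too large for integrability. Nonlinear asymptotics can be avoided by arguing with an
  energy. Put \<open>P = (g\<^sup>2 - 1)/2\<close>, so that \<open>P \<approx> -h\<close>, and \<open>w = P' = g g'\<close>. One integration of the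
  equation gives a forced oscillator
  \<open>P'' = z h / 3 + c\<close> with \<open>c' = - h / 3\<close>. Its Newtonian energy
  \<open>E = w\<^sup>2/2 + z h\<^sup>2 (3 - 2h)/18 - c P\<close> decays, but the corrected quantity
  \<open>M = z E - P w / 2 + (9/4) c\<^sup>2\<close> has the derivative
  \<open>M' = h\<^sup>2 (z (1/6 - 5h/36) - (3/4) c)\<close>, exactly, and for large \<open>z\<close> it dominates
  \<open>z w\<^sup>2/4 + z\<^sup>2 h\<^sup>2/50 + c\<^sup>2/10\<close>. Hence \<open>M\<close> is eventually nonnegative and nondecreasing.

  Now suppose that \<open>h\<close> is integrable. Then \<open>M' \<le> \<bar>h\<bar> (M + 50)\<close> bounds \<open>M\<close> by Gronwall's argument
  (\<open>M_bounded\<close>), so that \<open>w\<close> tends to zero, and then \<open>c\<close> tends to zero as well, because a nonzero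
  limit would make \<open>w / z\<close> grow logarithmically. If \<open>M\<close> were ever a positive number \<open>m\<close>, it would
  stay above \<open>m\<close>, and the virial identity for \<open>(P w)'\<close> would force the bounded function
  \<open>P w + 10 M + 4 K \<integral>\<bar>h\<bar>\<close> (\<open>K\<close> a bound for \<open>\<bar>c\<bar>\<close>) to grow at least like \<open>m ln z\<close>. So \<open>M\<close> vanishes
  eventually, which means \<open>g = -1\<close> on a ray (\<open>tail_eventually_constant\<close>). By analyticity \<open>g = -1\<close>
  everywhere, contradicting \<open>g 0 = 0\<close>.
\<close>

section \<open>Growth at infinity\<close>

text \<open>This is how both contradictions at infinity arise: integrating \<open>a / z\<close> produces \<open>a ln z\<close>,
  and no bounded function can keep up with it.\<close>
lemma unbounded_of_log_growth:
  fixes F F' :: "real \<Rightarrow> real"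
  assumes "a > 0" 
    and "eventually (\<lambda>z. (F has_real_derivative F' z) (at z) \<and> a / z \<le> F' z) at_top"
    and "eventually (\<lambda>z. F z \<le> K) at_top"
  shows False
proof -
  obtain z0 where z0: "z0 \<ge> 1" 
    and F: "\<And>z. z \<ge> z0 \<Longrightarrow> (F has_real_derivative F' z) (at z) \<and> a / z \<le> F' z \<and> F z \<le> K"
    using eventually_conj[OF eventually_conj[OF assms(2,3)] eventually_ge_at_top[of 1]]
    unfolding eventually_at_top_linorder by (metis order_refl)
  have mono: "F z0 - a * ln z0 \<le> F z - a * ln z" if "z \<ge> z0" for z
  proof (rule DERIV_nonneg_imp_nondecreasing[OF that])
    fix x assume "z0 \<le> x" "x \<le> z"
    then show "\<exists>y. ((\<lambda>z. F z - a * ln z) has_real_derivative y) (at x) \<and> 0 \<le> y"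
      using z0 F[of x]
      by (intro exI[of _ "F' x - a * (1 / x)"]) (auto intro!: derivative_eq_intros)
  qed
  have "filterlim (\<lambda>z. a * ln z) at_top at_top"
    by (rule filterlim_tendsto_pos_mult_at_top[OF tendsto_const \<open>a > 0\<close> ln_at_top])
  then have "eventually (\<lambda>z. a * ln z \<ge> K - (F z0 - a * ln z0) + 1) at_top"
    by (simp add: filterlim_at_top)
  then obtain z where "z \<ge> z0" "a * ln z \<ge> K - (F z0 - a * ln z0) + 1"
    using eventually_happens[OF eventually_conj[OF _ eventually_ge_at_top[of z0]]] by force
  with mono[of z] F[of z] show False by simp
qed

lemma eventually_at_top_threshold:
  fixes P :: "'a :: linorder \<Rightarrow> bool"
  assumes "eventually P at_top"
  shows "\<exists>a\<ge>b. \<forall>z\<ge>a. P z"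
proof -
  from assms obtain a where "\<forall>z\<ge>a. P z" unfolding eventually_at_top_linorder by blast
  then show ?thesis by (intro exI[of _ "max a b"]) auto
qed

section \<open>Real analytic functions\<close>

lemma real_analytic_deriv:
  assumes "real_analytic f"
  shows "(f has_real_derivative deriv f x) (at x)" and "real_analytic (deriv f)"
proof -
  have *: "\<exists>a r. r > 0 \<and> (\<forall>y. \<bar>y - x\<bar> < r \<longrightarrow> 
      (f has_real_derivative deriv f y) (at y) \<and> (\<lambda>n. a n * (y - x) ^ n) sums deriv f y)" for x
  proof -
    obtain a r where r: "r > 0" and S: "\<And>y. \<bar>y - x\<bar> < r \<Longrightarrow> (\<lambda>n. a n * (y - x) ^ n) sums f y"
      using assms unfolding real_analytic_def by metis
    have sm: "summable (\<lambda>n. a n * t ^ n)" if "norm t < r" for t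
      using S[of "x + t"] that by (auto simp: sums_iff)
    have "(f has_real_derivative deriv f y) (at y) \<and> (\<lambda>n. diffs a n * (y - x) ^ n) sums deriv f y"
      if y: "\<bar>y - x\<bar> < r" for y
    proof -
      define D where "D = (\<Sum>n. diffs a n * (y - x) ^ n)"
      have "((\<lambda>t. \<Sum>n. a n * t ^ n) has_real_derivative D) (at (y - x))"
        unfolding D_def by (rule termdiffs_strong'[of r]) (use y sm in auto)
      then have "((\<lambda>t. \<Sum>n. a n * (t - x) ^ n) has_real_derivative D) (at y)"
        using DERIV_shift[of "\<lambda>t. \<Sum>n. a n * t ^ n" D y "- x"] by simp
      then have "(f has_real_derivative D) (at y)"
      proof (rule DERIV_cong_ev[THEN iffD1, rotated -1])
        have "eventually (\<lambda>t. t \<in> ball x r) (nhds y)"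
          using y by (intro eventually_nhds_in_open) (auto simp: dist_real_def)
        then show "eventually (\<lambda>t. (\<Sum>n. a n * (t - x) ^ n) = f t) (nhds y)"
          by eventually_elim (use S in \<open>auto simp: sums_iff dist_real_def abs_minus_commute\<close>)
      qed auto
      moreover have "summable (\<lambda>n. diffs a n * (y - x) ^ n)"
        by (rule termdiff_converges[of _ r]) (use y sm in auto)
      ultimately show ?thesis
        using DERIV_imp_deriv[of f D y] by (auto simp: D_def)
    qed
    with r show ?thesis by blast
  qed
  show "(f has_real_derivative deriv f x) (at x)" using *[of x] by force
  show "real_analytic (deriv f)" unfolding real_analytic_def using * by meson
qed

text \<open>The identity theorem in the form needed here. At the left end of the maximal ray on which
  \<open>f = k\<close>, every coefficient of the power series of \<open>f - k\<close> vanishes, since a nonzero power series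
  has isolated zeros. So the ray could be extended to the left.\<close>
lemma real_analytic_const_of_ray:
  assumes f: "real_analytic f" and ray: "\<And>x. x \<ge> b \<Longrightarrow> f x = k"
  shows "f y = k"
proof (rule ccontr)
  assume ne: "f y \<noteq> k"
  define T where "T = {x. f x \<noteq> k}"
  have T: "T \<noteq> {}" "bdd_above T"
    using ne ray by (auto simp: T_def intro!: bdd_aboveI[of _ b]) (meson linear)
  define x0 where "x0 = Sup T"
  have cont: "isCont f x" for x using real_analytic_deriv(1)[OF f] DERIV_isCont by blast
  have right: "f x = k" if "x > x0" for x
    using that cSup_upper[OF _ T(2), of x] unfolding x0_def T_def by force
  have at: "f x0 = k"
  proof (rule tendsto_unique[of "at_right x0"])
    show "(f \<longlongrightarrow> f x0) (at_right x0)"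
      using cont[of x0] unfolding isCont_def by (rule filterlim_mono) (auto simp: at_le)
    show "(f \<longlongrightarrow> k) (at_right x0)"
      by (rule tendsto_eventually) (auto simp: eventually_at_right_field right intro!: exI[of _ "x0 + 1"])
  qed simp
  obtain a r where r: "r > 0" and S: "\<And>y. \<bar>y - x0\<bar> < r \<Longrightarrow> (\<lambda>n. a n * (y - x0) ^ n) sums f y"
    using f unfolding real_analytic_def by metis
  have a0: "a 0 = k" using S[of x0] r at powser_sums_zero_iff[of a] by simp
  \<comment> \<open>The coefficients of \<open>f - k\<close> at \<open>x0\<close>.\<close>
  define e where "e = a(0 := 0)"
  have S': "(\<lambda>n. e n * (y - x0) ^ n) sums (f y - k)" if "norm (y - x0) < r" for y
  proof -
    have "(\<lambda>n. if n = 0 then k else 0) sums k" using sums_single[of 0 "\<lambda>_. k"] by simp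
    from sums_diff[OF S[of y] this] that have "(\<lambda>n. a n * (y - x0) ^ n - (if n = 0 then k else 0)) sums (f y - k)"
      by simp
    then show ?thesis by (rule sums_cong[THEN iffD1, rotated]) (simp add: e_def a0)
  qed
  have "e n = 0" for n
  proof (rule ccontr)
    assume n: "e n \<noteq> 0"
    then have "n > 0" by (auto simp: e_def intro: gr0I)
    then obtain s where "s > 0" "\<And>z. z \<in> cball x0 s - {x0} \<Longrightarrow> f z - k \<noteq> 0"
      using powser_0_nonzero[of r x0 e "\<lambda>x. f x - k" n] r S' at n by auto
    from this(2)[of "x0 + s"] this(1) right[of "x0 + s"] show False by (auto simp: dist_real_def)
  qed
  then have e0: "e = (\<lambda>n. 0)" by auto
  have "f y = k" if "\<bar>y - x0\<bar> < r" for y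
    using S'[of y] that sums_unique2[OF _ sums_zero] unfolding e0 by force
  moreover obtain x where "x \<in> T" "x0 - r < x"
    using less_cSup_iff[OF T, of "x0 - r"] r by (auto simp: x0_def)
  moreover have "x \<le> x0" using cSup_upper[OF _ T(2)] \<open>x \<in> T\<close> by (simp add: x0_def)
  ultimately show False using r by (auto simp: T_def)
qed

section \<open>The corrected energy\<close>

text \<open>With \<open>y = z h\<close>, the potential part is close to the quadratic form \<open>y\<^sup>2/6 + c y + (9/4) c\<^sup>2\<close>,
  whose discriminant \<open>1 - 3/2\<close> is negative. The cubic corrections are absorbed because \<open>h\<close> is small,
  and \<open>p w / 2\<close> is absorbed by the kinetic term because \<open>z\<close> is large.\<close>
lemma energy_coercive:
  fixes z h w c p :: real
  assumes z: "z \<ge> 10" and h: "\<bar>h\<bar> \<le> 1/100" and p: "p = - h * (1 - h/2)"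
  shows "z * w\<^sup>2 / 4 + z\<^sup>2 * h\<^sup>2 / 50 + c\<^sup>2 / 10
    \<le> z * w\<^sup>2 / 2 - p * w / 2 + z\<^sup>2 * h\<^sup>2 * (3 - 2*h) / 18 - z * c * p + 9/4 * c\<^sup>2"
proof -
  define y where "y = z * h"
  define Q where "Q = y\<^sup>2 * ((3 - 2*h) / 18)"
  define R where "R = c * y * (1 - h/2)"
  have q: "\<bar>1 - h/2\<bar> \<le> 201/200" using h by (simp add: abs_le_iff)
  \<comment> \<open>Completing the square in \<open>w\<close>.\<close>
  have "p * w / 2 - z * w\<^sup>2 / 4 \<le> p\<^sup>2 / (4*z)"
  proof -
    have "z * w\<^sup>2 / 4 - p * w / 2 + p\<^sup>2 / (4*z) = z * (w/2 - p / (2*z))\<^sup>2"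
      using z by (simp add: field_simps power2_eq_square)
    moreover have "0 \<le> z * (w/2 - p / (2*z))\<^sup>2" using z by simp
    ultimately show ?thesis by linarith
  qed
  also have "p\<^sup>2 / (4*z) \<le> y\<^sup>2 / 1000"
  proof -
    have "\<bar>p\<bar> \<le> \<bar>h\<bar> * (201/200)" unfolding p abs_mult abs_minus_cancel by (rule mult_left_mono[OF q]) simp
    then have "\<bar>p\<bar> \<le> 2 * \<bar>h\<bar>" using abs_ge_zero[of h] by linarith
    then have "p\<^sup>2 \<le> 4 * h\<^sup>2" using power_mono[of "\<bar>p\<bar>" "2 * \<bar>h\<bar>" 2] by (simp add: power_mult_distrib)
    moreover have "1000 * h\<^sup>2 \<le> z^3 * h\<^sup>2"
      using power_mono[of 10 z 3] z by (intro mult_right_mono) auto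
    ultimately have "p\<^sup>2 * 1000 \<le> 4 * z * y\<^sup>2" 
      by (simp add: y_def power_mult_distrib power2_eq_square power3_eq_cube algebra_simps)
    then show ?thesis using z by (simp add: field_simps)
  qed
  finally have "p * w / 2 - z * w\<^sup>2 / 4 \<le> y\<^sup>2 / 1000" .
  moreover have "149/900 * y\<^sup>2 \<le> Q"
    unfolding Q_def using mult_left_mono[of "149/900" "(3 - 2*h) / 18" "y\<^sup>2"] h by (simp add: mult.commute abs_le_iff)
  moreover have "- R \<le> 201/1600 * y\<^sup>2 + 201/100 * c\<^sup>2"
  proof -
    \<comment> \<open>The weights leave a positive remainder of both squares: \<open>1/8 < 1/6\<close> and \<open>2 < 9/4\<close>.\<close>
    have "\<bar>c * y\<bar> \<le> y\<^sup>2 / 8 + 2 * c\<^sup>2"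
      using sum_squares_ge_zero[of "y/4 + c" 0] sum_squares_ge_zero[of "y/4 - c" 0]
      by (simp add: abs_le_iff power2_eq_square algebra_simps)
    then have "\<bar>c * y * (1 - h/2)\<bar> \<le> (y\<^sup>2 / 8 + 2 * c\<^sup>2) * (201/200)"
      unfolding abs_mult[of "c * y"] by (rule mult_mono[OF _ q]) auto
    then show ?thesis unfolding R_def by (simp add: abs_le_iff algebra_simps)
  qed
  moreover have "z\<^sup>2 * h\<^sup>2 * (3 - 2*h) / 18 = Q" "z * c * p = - R"
    "z\<^sup>2 * h\<^sup>2 / 50 = y\<^sup>2 / 50"
    by (simp_all add: Q_def R_def y_def p power_mult_distrib algebra_simps)
  moreover have "0 \<le> y\<^sup>2" "0 \<le> c\<^sup>2" by simp_all
  ultimately show ?thesis by (simp only:)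
qed

text \<open>The two-sided comparison with \<open>z h\<^sup>2\<close> of what will be the derivative of the corrected
  energy.\<close>
lemma production_bounds:
  fixes z h c K :: real
  assumes "z \<ge> 10 * K + 1" and "\<bar>h\<bar> \<le> 1/100" and "\<bar>c\<bar> \<le> K"
  shows "z * h\<^sup>2 / 12 \<le> h\<^sup>2 * (z * (1/6 - 5*h/36) - 3/4 * c)"
    and "h\<^sup>2 * (z * (1/6 - 5*h/36) - 3/4 * c) \<le> z * h\<^sup>2 / 3"
proof -
  have zh: "\<bar>z * h\<bar> \<le> z * (1/100)"
    using mult_left_mono[OF assms(2), of z] assms by (simp add: abs_mult)
  have eq: "z * (1/6 - 5*h/36) = z / 6 - 5/36 * (z * h)" by (simp add: algebra_simps)
  have lo: "z / 12 \<le> z * (1/6 - 5*h/36) - 3/4 * c"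
    and hi: "z * (1/6 - 5*h/36) - 3/4 * c \<le> z / 3"
    unfolding eq using zh assms(1,3) by linarith+
  show "z * h\<^sup>2 / 12 \<le> h\<^sup>2 * (z * (1/6 - 5*h/36) - 3/4 * c)"
    using mult_left_mono[OF lo zero_le_power2[of h]] by (simp add: mult.commute)
  show "h\<^sup>2 * (z * (1/6 - 5*h/36) - 3/4 * c) \<le> z * h\<^sup>2 / 3"
    using mult_left_mono[OF hi zero_le_power2[of h]] by (simp add: mult.commute)
qed

text \<open>A right tail of a profile, assumed integrable towards the limit \<open>-1\<close>; \<open>d\<close> stands for
  \<open>(g g')'\<close>. Such tails turn out to be trivial.\<close>
locale integrable_tail =
  fixes g g' d :: "real \<Rightarrow> real"
  assumes g_deriv: "\<And>z. (g has_real_derivative g' z) (at z)"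
    and flux_deriv: "\<And>z. ((\<lambda>y. g y * g' y) has_real_derivative d z) (at z)"
    and profile_ode: "\<And>z. (d has_real_derivative 1/3 * z * g' z) (at z)"
    and limit: "(g \<longlongrightarrow> - 1) at_top"
    and integrable: "set_integrable lborel {0..} (\<lambda>z. 1 + g z)"
begin

definition h where "h z = 1 + g z"
text \<open>\<open>P\<close> is the displacement of the oscillator, \<open>w\<close> its velocity, and \<open>c\<close> the slowly varying part of
  its acceleration \<open>d\<close>, the restoring force being \<open>z h / 3\<close>.\<close>
definition P where "P z = ((g z)\<^sup>2 - 1) / 2"
definition w where "w z = g z * g' z"
definition c where "c z = d z - z * h z / 3"
text \<open>\<open>M\<close> is \<open>z\<close> times the energy \<open>w\<^sup>2/2 + z h\<^sup>2 (3 - 2h)/18 - c P\<close>, where the potential comes from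
  \<open>(h\<^sup>2 (3 - 2h)/6)' = - h w\<close>, plus two corrections. Their coefficients are forced: \<open>-1/2\<close> cancels the
  terms \<open>w\<^sup>2\<close>, and \<open>9/4\<close> the terms \<open>c h\<close>, in the derivative \<open>D\<close> of \<open>M\<close>.\<close>
definition M where "M z = z * (w z)\<^sup>2 / 2 - P z * w z / 2 + z\<^sup>2 * (h z)\<^sup>2 * (3 - 2 * h z) / 18
    - z * c z * P z + 9/4 * (c z)\<^sup>2"
definition D where "D z = (h z)\<^sup>2 * (z * (1/6 - 5 * h z / 36) - 3/4 * c z)"
definition A where "A z = integral {0..z} (\<lambda>x. \<bar>h x\<bar>)"

lemma P_eq: "P z = - h z * (1 - h z / 2)"
  by (simp add: P_def h_def power2_eq_square field_simps)

lemma h_deriv: "(h has_real_derivative g' z) (at z)"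
  unfolding h_def by (auto intro!: derivative_eq_intros g_deriv)

lemma P_deriv: "(P has_real_derivative w z) (at z)"
  unfolding P_def w_def by (auto intro!: derivative_eq_intros g_deriv)

lemma w_deriv: "(w has_real_derivative c z + z * h z / 3) (at z)"
  using flux_deriv[of z] by (simp add: w_def[abs_def] c_def)

lemma c_deriv: "(c has_real_derivative - h z / 3) (at z)"
  unfolding c_def by (auto intro!: derivative_eq_intros profile_ode h_deriv simp: field_simps)

text \<open>The derivative \<open>g'\<close> enters the computation only through \<open>(1 - h) g' = - w\<close>, and \<open>w\<close> then
  cancels completely.\<close>
lemma M_deriv: "(M has_real_derivative D z) (at z)"
proof -
  have "(M has_real_derivative
     ((w z)\<^sup>2 / 2 + z * (w z * (c z + z * h z / 3)) - (w z * w z + P z * (c z + z * h z / 3)) / 2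
      + (2 * z * (h z)\<^sup>2 * (3 - 2 * h z) + z\<^sup>2 * (6 * h z * g' z - 6 * (h z)\<^sup>2 * g' z)) / 18
      - (c z * P z + z * (- h z / 3) * P z + z * c z * w z) + 9/4 * (2 * c z * (- h z / 3)))) (at z)"
    unfolding M_def
    by (auto intro!: derivative_eq_intros h_deriv P_deriv w_deriv c_deriv) 
       (simp add: field_simps power2_eq_square)
  moreover have "6 * h z * g' z - 6 * (h z)\<^sup>2 * g' z = - 6 * h z * w z"
    by (simp add: h_def w_def power2_eq_square algebra_simps)
  ultimately show ?thesis
    by (elim DERIV_cong) (simp add: D_def P_eq, simp add: field_simps power2_eq_square)
qed

section \<open>Consequences of an integrable tail\<close>

lemma h_tendsto: "(h \<longlongrightarrow> 0) at_top"
  using tendsto_add[OF tendsto_const limit, of 1] by (simp add: h_def[abs_def])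

lemma P_tendsto: "(P \<longlongrightarrow> 0) at_top"
  unfolding P_eq[abs_def] by (auto intro!: tendsto_eq_intros h_tendsto)

lemma h_continuous: "continuous_on S h"
  by (meson DERIV_isCont continuous_at_imp_continuous_on h_deriv)

lemma h_set_integrable: "set_integrable lborel {0..} h"
  using integrable by (simp add: h_def[abs_def])

lemma A_deriv: "(A has_real_derivative \<bar>h z\<bar>) (at z)" if "z > 0"
proof -
  have "(A has_real_derivative \<bar>h z\<bar>) (at z within {0..z+1})"
    unfolding A_def using that
    by (intro integral_has_real_derivative continuous_intros h_continuous) auto
  moreover have "at z within {0..z+1} = at z"
    using that by (intro at_within_interior) auto
  ultimately show ?thesis by simp
qed

lemma A_bounded: "\<exists>B. \<forall>z. A z \<le> B"
proof (intro exI allI)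
  have int: "(\<lambda>x. \<bar>h x\<bar>) integrable_on {0..}"
    using set_borel_integral_eq_integral(1)[OF set_integrable_abs[OF h_set_integrable]] .
  show "A z \<le> integral {0..} (\<lambda>x. \<bar>h x\<bar>)" for z
    unfolding A_def
    by (intro integral_subset_le int integrable_continuous_interval continuous_intros h_continuous) auto
qed

text \<open>Here \<open>c\<close> is a constant minus a third of \<open>\<integral>h\<close>, which converges by integrability.\<close>
lemma c_convergent: obtains C where "(c \<longlongrightarrow> C) at_top"
proof
  have c_eq: "c 0 - 1/3 * (LINT x:{0..z}|lborel. h x) = c z" if "z \<ge> 0" for z
  proof -
    have "((\<lambda>x. - h x / 3) has_integral (c z - c 0)) {0..z}"
      using has_field_derivative_at_within[OF c_deriv]
      by (intro fundamental_theorem_of_calculus that)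
         (simp only: has_real_derivative_iff_has_vector_derivative)
    then have "integral {0..z} (\<lambda>x. (-1/3) * h x) = c z - c 0" 
      by (intro integral_unique) simp
    moreover have "set_integrable lborel {0..z} h"
      by (rule set_integrable_subset[OF h_set_integrable]) auto
    ultimately show ?thesis by (simp add: set_borel_integral_eq_integral(2))
  qed
  have "((\<lambda>z. c 0 - 1/3 * (LINT x:{0..z}|lborel. h x)) \<longlongrightarrow> c 0 - 1/3 * (LINT x:{0..}|lborel. h x)) at_top"
    by (intro tendsto_intros tendsto_set_lebesgue_integral_at_top h_set_integrable) auto
  then show "(c \<longlongrightarrow> c 0 - 1/3 * (LINT x:{0..}|lborel. h x)) at_top"
    by (rule Lim_transform_eventually) (rule eventually_mono[OF eventually_ge_at_top[of 0] c_eq])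
qed

lemma h_small: "eventually (\<lambda>z. \<bar>h z\<bar> \<le> 1/100) at_top"
proof -
  have "eventually (\<lambda>z. \<bar>h z\<bar> < 1/100) at_top" 
    by (rule order_tendstoD(2)[of _ 0]) (auto intro!: tendsto_rabs_zero h_tendsto)
  then show ?thesis by eventually_elim simp
qed

lemma c_bounded: obtains K where "K \<ge> 0" "eventually (\<lambda>z. \<bar>c z\<bar> \<le> K) at_top"
proof -
  obtain C where C: "(c \<longlongrightarrow> C) at_top" by (rule c_convergent)
  have "eventually (\<lambda>z. \<bar>c z\<bar> < \<bar>C\<bar> + 1) at_top"
    by (rule order_tendstoD(2)[OF tendsto_rabs[OF C]]) auto
  then have "eventually (\<lambda>z. \<bar>c z\<bar> \<le> \<bar>C\<bar> + 1) at_top" by eventually_elim simp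
  then show thesis by (intro that[of "\<bar>C\<bar> + 1"]) auto
qed

lemma M_coercive:
  "eventually (\<lambda>z. z * (w z)\<^sup>2 / 4 + z\<^sup>2 * (h z)\<^sup>2 / 50 + (c z)\<^sup>2 / 10 \<le> M z) at_top"
  using h_small eventually_ge_at_top[of 10]
proof eventually_elim
  case (elim z)
  show ?case unfolding M_def by (rule energy_coercive[OF elim(2,1) P_eq])
qed

lemma D_bounds:
  "eventually (\<lambda>z. z * (h z)\<^sup>2 / 12 \<le> D z \<and> D z \<le> z * (h z)\<^sup>2 / 3) at_top"
proof -
  obtain K where "eventually (\<lambda>z. \<bar>c z\<bar> \<le> K) at_top" by (rule c_bounded)
  then show ?thesis
    using h_small eventually_ge_at_top[of "10 * K + 1"]
  proof eventually_elim
    case (elim z)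
    show ?case
      unfolding D_def using production_bounds[OF elim(3,2,1)] by (rule conjI)
  qed
qed

lemma M_mono:
  assumes "\<And>z. z \<ge> a \<Longrightarrow> z * (h z)\<^sup>2 / 12 \<le> D z" "0 \<le> a" "a \<le> x" "x \<le> y"
  shows "M x \<le> M y"
proof (rule DERIV_nonneg_imp_nondecreasing[OF assms(4)])
  fix z assume "x \<le> z" "z \<le> y"
  then have "a \<le> z" using assms(3) by linarith
  then have "0 \<le> D z"
    using order_trans[of 0 "z * (h z)\<^sup>2 / 12" "D z"] assms(1)[of z] assms(2) by simp
  then show "\<exists>y. (M has_real_derivative y) (at z) \<and> 0 \<le> y"
    by (intro exI[of _ "D z"] conjI M_deriv)
qed

text \<open>Coercivity gives \<open>z \<bar>h\<bar> \<le> z\<^sup>2 h\<^sup>2 / 50 + 50 \<le> M + 50\<close>, so that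
  \<open>M' \<le> z h\<^sup>2 / 3 \<le> \<bar>h\<bar> (M + 50)\<close>. As \<open>\<bar>h\<bar>\<close> is integrable, Gronwall's argument bounds \<open>M\<close>.\<close>
lemma M_bounded: obtains B where "eventually (\<lambda>z. M z \<le> B) at_top"
proof -
  obtain a where a: "a \<ge> 10"
    and far: "\<forall>z\<ge>a. (z * (w z)\<^sup>2 / 4 + z\<^sup>2 * (h z)\<^sup>2 / 50 + (c z)\<^sup>2 / 10 \<le> M z)
      \<and> z * (h z)\<^sup>2 / 12 \<le> D z \<and> D z \<le> z * (h z)\<^sup>2 / 3"
    using eventually_at_top_threshold[OF eventually_conj[OF M_coercive D_bounds], of 10]
    by (elim exE conjE) (rule that)
  note lower = far[rule_format, THEN conjunct1] and upper = far[rule_format, THEN conjunct2, THEN conjunct2]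
  obtain B where B: "\<forall>z. A z \<le> B" using A_bounded by blast
  have D_le: "D z \<le> \<bar>h z\<bar> * (M z + 50)" and M_ge: "0 \<le> M z" if "z \<ge> a" for z
  proof -
    have "0 \<le> z * (w z)\<^sup>2 / 4" "0 \<le> (c z)\<^sup>2 / 10" "0 \<le> z\<^sup>2 * (h z)\<^sup>2 / 50" using that a by auto
    then have *: "z\<^sup>2 * (h z)\<^sup>2 / 50 \<le> M z" and M0: "0 \<le> M z"
      using lower[OF that] by linarith+
    have "0 \<le> (z * \<bar>h z\<bar> / 50 - 1)\<^sup>2" by simp
    then have "z * \<bar>h z\<bar> \<le> z\<^sup>2 * (h z)\<^sup>2 / 50 + 50"
      using mult_nonneg_nonneg[of "z\<^sup>2" "(h z)\<^sup>2"] by (simp add: power2_eq_square algebra_simps)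
    then have "z * \<bar>h z\<bar> / 3 \<le> M z + 50" using * M0 by linarith
    then have "\<bar>h z\<bar> * (z * \<bar>h z\<bar> / 3) \<le> \<bar>h z\<bar> * (M z + 50)"
      by (rule mult_left_mono) auto
    moreover have "\<bar>h z\<bar> * (z * \<bar>h z\<bar> / 3) = z * (h z)\<^sup>2 / 3"
      by (simp add: power2_eq_square algebra_simps)
    ultimately show "D z \<le> \<bar>h z\<bar> * (M z + 50)" using upper[OF that] by linarith
    show "0 \<le> M z" by fact
  qed
  have "M z \<le> (M a + 50) * exp (- A a) * exp B" if z: "z \<ge> a" for z
  proof -
    have "(M z + 50) * exp (- A z) \<le> (M a + 50) * exp (- A a)"
    proof (rule DERIV_nonpos_imp_nonincreasing[OF z])
      fix x assume x: "a \<le> x" "x \<le> z"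
      show "\<exists>y. ((\<lambda>z. (M z + 50) * exp (- A z)) has_real_derivative y) (at x) \<and> y \<le> 0"
      proof (intro exI conjI)
        show "((\<lambda>z. (M z + 50) * exp (- A z)) has_real_derivative
            (D x - \<bar>h x\<bar> * (M x + 50)) * exp (- A x)) (at x)"
          using x a by (auto intro!: derivative_eq_intros M_deriv A_deriv simp: algebra_simps)
        show "(D x - \<bar>h x\<bar> * (M x + 50)) * exp (- A x) \<le> 0"
          using D_le[OF x(1)] by (intro mult_nonpos_nonneg) simp_all
      qed
    qed
    then have "M z + 50 \<le> (M a + 50) * exp (- A a) * exp (A z)"
      by (simp add: exp_minus field_simps)
    also have "\<dots> \<le> (M a + 50) * exp (- A a) * exp B"
      using B M_ge[of a] by (intro mult_left_mono) auto
    finally show ?thesis by simp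
  qed
  then show thesis
    by (intro that[of "(M a + 50) * exp (- A a) * exp B"]) 
       (auto simp: eventually_at_top_linorder intro!: exI[of _ a])
qed

lemma w_tendsto: "(w \<longlongrightarrow> 0) at_top"
proof -
  obtain B where B: "eventually (\<lambda>z. M z \<le> B) at_top" by (rule M_bounded)
  have "((\<lambda>z. (w z)\<^sup>2) \<longlongrightarrow> 0) at_top"
  proof (rule tendsto_sandwich[of "\<lambda>_. 0" _ _ "\<lambda>z. 4 * B / z"])
    show "eventually (\<lambda>z. (w z)\<^sup>2 \<le> 4 * B / z) at_top"
      using B M_coercive eventually_gt_at_top[of 0]
    proof eventually_elim
      case (elim z)
      have "0 \<le> (c z)\<^sup>2 / 10" "0 \<le> z\<^sup>2 * (h z)\<^sup>2 / 50" by simp_all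
      then have "z * (w z)\<^sup>2 / 4 \<le> B" using elim by linarith
      then show ?case using elim by (simp add: field_simps)
    qed
    show "((\<lambda>z. 4 * B / z) \<longlongrightarrow> 0) at_top"
      by (intro tendsto_divide_0[OF tendsto_const] filterlim_at_top_imp_at_infinity filterlim_ident)
  qed auto
  then show ?thesis by simp
qed

text \<open>Suppose that the limit \<open>C\<close> is not zero. As \<open>(w / z)' = (c - w / z) / z + h / 3\<close>, where \<open>h\<close> is
  integrable and \<open>w / z \<rightarrow> 0\<close>, the function \<open>C w / z\<close> would grow like \<open>C\<^sup>2 ln z\<close>.\<close>
lemma c_tendsto: "(c \<longlongrightarrow> 0) at_top"
proof -
  obtain C where C: "(c \<longlongrightarrow> C) at_top" by (rule c_convergent)
  obtain B where B: "\<forall>z. A z \<le> B" using A_bounded by blast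
  have wz: "((\<lambda>z. w z / z) \<longlongrightarrow> 0) at_top"
    by (intro tendsto_divide_0[OF w_tendsto] filterlim_at_top_imp_at_infinity filterlim_ident)
  have "C = 0"
  proof (rule ccontr)
    assume "C \<noteq> 0"
    define F where "F z = C * (w z / z) + \<bar>C\<bar> * A z / 3" for z
    define F' where "F' z = C * (c z - w z / z) / z + (C * h z + \<bar>C * h z\<bar>) / 3" for z
    have lim: "((\<lambda>z. C * (c z - w z / z)) \<longlongrightarrow> C * (C - 0)) at_top"
      by (intro tendsto_intros C wz)
    have "eventually (\<lambda>z. C\<^sup>2 / 2 < C * (c z - w z / z)) at_top"
      by (rule order_tendstoD(1)[OF lim]) (use zero_less_power2[of C] \<open>C \<noteq> 0\<close> in \<open>simp add: power2_eq_square del: zero_less_power2\<close>)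
    then have 1: "eventually (\<lambda>z. (F has_real_derivative F' z) (at z) \<and> C\<^sup>2 / 2 / z \<le> F' z) at_top"
      using eventually_gt_at_top[of 0]
    proof eventually_elim
      case (elim z)
      have "(F has_real_derivative F' z) (at z)"
        unfolding F_def F'_def using elim
        by (auto intro!: derivative_eq_intros w_deriv A_deriv simp: field_simps power2_eq_square abs_mult)
      moreover have "C\<^sup>2 / 2 / z \<le> C * (c z - w z / z) / z"
        using elim by (intro divide_right_mono) auto
      moreover have "0 \<le> (C * h z + \<bar>C * h z\<bar>) / 3" by simp
      ultimately show ?case unfolding F'_def by (intro conjI) (assumption, linarith)
    qed
    have "eventually (\<lambda>z. C * (w z / z) < 1) at_top"
      by (rule order_tendstoD(2)[OF tendsto_mult_right_zero[OF wz]]) simp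
    then have 2: "eventually (\<lambda>z. F z \<le> 1 + \<bar>C\<bar> * B / 3) at_top"
    proof eventually_elim
      case (elim z)
      have "\<bar>C\<bar> * A z \<le> \<bar>C\<bar> * B" by (intro mult_left_mono B[rule_format]) auto
      with elim show ?case by (simp add: F_def)
    qed
    show False 
      by (rule unbounded_of_log_growth[OF _ 1 2]) (use \<open>C \<noteq> 0\<close> in simp)
  qed
  with C show ?thesis by simp
qed

text \<open>The virial identity: \<open>(P w)' = w\<^sup>2 + P P''\<close>, with \<open>w\<^sup>2\<close> eliminated in favour of \<open>M\<close>. The
  unfavourable terms are of size \<open>z h\<^sup>2\<close>, compensated by \<open>10 M'\<close>, or of size \<open>c P\<close>, compensated by
  \<open>4 K \<bar>h\<bar>\<close>. What remains beside \<open>2 M\<close> in the numerator tends to zero.\<close>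
lemma action_growth:
  assumes K: "\<bar>c z\<bar> \<le> K" and h: "\<bar>h z\<bar> \<le> 1/100" and z: "z > 0" and D: "z * (h z)\<^sup>2 / 12 \<le> D z"
  shows "(2 * M z + P z * w z - 9/2 * (c z)\<^sup>2) / z 
    \<le> (w z)\<^sup>2 + P z * (c z + z * h z / 3) + 10 * D z + 4 * K * \<bar>h z\<bar>"
proof -
  have "(2 * M z + P z * w z - 9/2 * (c z)\<^sup>2) / z
     = (w z)\<^sup>2 + z * (h z)\<^sup>2 * (3 - 2 * h z) / 9 - 2 * c z * P z"
    using z by (simp add: M_def field_simps power2_eq_square)
  moreover have "P z * (c z + z * h z / 3) = c z * P z - z * (h z)\<^sup>2 * (1 - h z / 2) / 3"
    by (simp add: P_eq power2_eq_square field_simps)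
  moreover have "- (4 * K * \<bar>h z\<bar>) \<le> 3 * (c z * P z)"
  proof -
    have "\<bar>P z\<bar> \<le> \<bar>h z\<bar> * (4/3)"
      unfolding P_eq abs_mult abs_minus_cancel using h by (intro mult_left_mono) (auto simp: abs_le_iff)
    then have "\<bar>c z * P z\<bar> \<le> K * (\<bar>h z\<bar> * (4/3))"
      unfolding abs_mult using K by (intro mult_mono) auto
    then show ?thesis by (simp add: abs_le_iff)
  qed
  moreover have "z * (h z)\<^sup>2 * (3 - 2 * h z) / 9 + z * (h z)\<^sup>2 * (1 - h z / 2) / 3 \<le> z * (h z)\<^sup>2 * (10/12)"
  proof -
    have "(3 - 2 * h z) / 9 + (1 - h z / 2) / 3 \<le> 10/12"
      using abs_le_D2[OF h] by (simp add: diff_divide_distrib)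
    then have "z * (h z)\<^sup>2 * ((3 - 2 * h z) / 9 + (1 - h z / 2) / 3) \<le> z * (h z)\<^sup>2 * (10/12)"
      using z by (intro mult_left_mono) auto
    then show ?thesis by (simp add: distrib_left)
  qed
  ultimately show ?thesis using D by linarith
qed

text \<open>A positive value \<open>m\<close> of \<open>M\<close> persists, and \<open>action_growth\<close> turns it into logarithmic growth of a
  bounded function. So \<open>M\<close> vanishes far out, and by coercivity so does \<open>h\<close>.\<close>
theorem tail_eventually_constant: "\<exists>b. \<forall>z\<ge>b. g z = - 1"
proof -
  obtain K where K: "K \<ge> 0" and ev: "eventually (\<lambda>z. \<bar>c z\<bar> \<le> K) at_top" by (rule c_bounded)
  obtain a where a: "a \<ge> 10" 
    and far: "\<forall>z\<ge>a. (\<bar>h z\<bar> \<le> 1/100 \<and> \<bar>c z\<bar> \<le> K)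
      \<and> (z * (w z)\<^sup>2 / 4 + z\<^sup>2 * (h z)\<^sup>2 / 50 + (c z)\<^sup>2 / 10 \<le> M z)
      \<and> z * (h z)\<^sup>2 / 12 \<le> D z \<and> D z \<le> z * (h z)\<^sup>2 / 3"
    using eventually_at_top_threshold[OF eventually_conj[OF eventually_conj[OF h_small ev] 
      eventually_conj[OF M_coercive D_bounds]], of 10]
    by (elim exE conjE) (rule that)
  note h = far[rule_format, THEN conjunct1, THEN conjunct1] and c = far[rule_format, THEN conjunct1, THEN conjunct2]
    and lower = far[rule_format, THEN conjunct2, THEN conjunct1]
    and D = far[rule_format, THEN conjunct2, THEN conjunct2, THEN conjunct1]
  have "M z \<le> 0" if "z \<ge> a" for z
  proof (rule ccontr)
    assume "\<not> M z \<le> 0"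
    define m where "m = M z"
    have m: "m > 0" using \<open>\<not> M z \<le> 0\<close> by (simp add: m_def)
    obtain B where B: "eventually (\<lambda>z. M z \<le> B) at_top" by (rule M_bounded)
    obtain B' where B': "\<forall>z. A z \<le> B'" using A_bounded by blast
    define F where "F x = P x * w x + 10 * M x + 4 * K * A x" for x
    define F' where "F' x = (w x)\<^sup>2 + P x * (c x + x * h x / 3) + 10 * D x + 4 * K * \<bar>h x\<bar>" for x
    have Pw: "((\<lambda>x. P x * w x) \<longlongrightarrow> 0) at_top"
      by (rule tendsto_mult_zero[OF P_tendsto w_tendsto])
    have "((\<lambda>x. P x * w x - 9/2 * (c x)\<^sup>2) \<longlongrightarrow> 0) at_top"
      using tendsto_diff[OF Pw tendsto_mult[OF tendsto_const[of "9/2"] tendsto_power[OF c_tendsto, of 2]]]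
      by simp
    then have "eventually (\<lambda>x. - m < P x * w x - 9/2 * (c x)\<^sup>2) at_top"
      by (rule order_tendstoD(1)) (use m in simp)
    then have 1: "eventually (\<lambda>x. (F has_real_derivative F' x) (at x) \<and> m / x \<le> F' x) at_top"
      using eventually_ge_at_top[of z]
    proof eventually_elim
      case (elim x)
      then have x: "x \<ge> a" "x > 0" using \<open>z \<ge> a\<close> a by auto
      have "(F has_real_derivative F' x) (at x)"
        unfolding F_def F'_def using x
        by (auto intro!: derivative_eq_intros P_deriv w_deriv A_deriv M_deriv simp: power2_eq_square)
      moreover have "m \<le> M x" unfolding m_def
        by (rule M_mono[OF D _ \<open>z \<ge> a\<close>]) (use a elim in auto)
      then have "m / x \<le> (2 * M x + P x * w x - 9/2 * (c x)\<^sup>2) / x"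
        using elim x by (intro divide_right_mono) auto
      moreover have "\<dots> \<le> F' x" unfolding F'_def 
        by (rule action_growth) (use c h D x in auto)
      ultimately show ?case by auto
    qed
    have "eventually (\<lambda>x. P x * w x < 1) at_top"
      by (rule order_tendstoD(2)[OF Pw]) auto
    then have 2: "eventually (\<lambda>x. F x \<le> 1 + 10 * B + 4 * K * B') at_top"
      using B
    proof eventually_elim
      case (elim x)
      have "4 * K * A x \<le> 4 * K * B'" using K by (intro mult_left_mono B'[rule_format]) auto
      with elim show ?case by (simp add: F_def)
    qed
    show False by (rule unbounded_of_log_growth[OF m 1 2])
  qed
  then have h0: "h z = 0" if "z \<ge> a" for z
  proof -
    have "0 \<le> z * (w z)\<^sup>2 / 4" "0 \<le> (c z)\<^sup>2 / 10" using that a by auto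
    then have "z\<^sup>2 * (h z)\<^sup>2 / 50 \<le> 0"
      using lower[OF that] \<open>\<And>z. z \<ge> a \<Longrightarrow> M z \<le> 0\<close>[OF that] by linarith
    then have "z * h z = 0" by (simp flip: power_mult_distrib)
    then show ?thesis using that a by simp
  qed
  show ?thesis
  proof (intro exI[of _ a] allI impI)
    show "g z = - 1" if "z \<ge> a" for z using h0[OF that] unfolding h_def by linarith
  qed
qed

end

section \<open>The two modes of convergence\<close>

lemma L1_norm_on_UNIV_rescale:
  assumes [measurable]: "g \<in> borel_measurable borel" and "t < 0"
  shows "L1_norm_on UNIV (\<lambda>x. u_minus g x t - S_minus x)
    = ennreal ((- t) powr (1/3)) * L1_norm_on UNIV (\<lambda>x. g x - S_minus x)"
proof -
  define \<tau> where "\<tau> = (- t) powr (1/3)"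
  have \<tau>: "\<tau> > 0" using \<open>t < 0\<close> by (simp add: \<tau>_def)
  have [measurable]: "S_minus \<in> borel_measurable borel" unfolding S_minus_def[abs_def] by measurable
  have "S_minus (\<tau> * x) = S_minus x" for x
    using \<tau> by (simp add: S_minus_def sgn_mult)
  then show ?thesis
    using nn_integral_real_affine[of "\<lambda>x. ennreal \<bar>u_minus g x t - S_minus x\<bar>" \<tau> 0] \<tau>
    by (simp add: L1_norm_on_def u_minus_def flip: \<tau>_def)
qed

lemma set_integrable_right_tail:
  assumes [measurable]: "g \<in> borel_measurable borel"
    and fin: "L1_norm_on UNIV (\<lambda>x. g x - S_minus x) < \<infinity>"
  shows "set_integrable lborel {0..} (\<lambda>z. 1 + g z)"
  unfolding set_integrable_def
proof (rule integrableI_bounded)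
  have "(\<integral>\<^sup>+ x. ennreal (norm (indicat_real {0..} x *\<^sub>R (1 + g x))) \<partial>lborel)
     \<le> (\<integral>\<^sup>+ x. ennreal \<bar>g x - S_minus x\<bar> \<partial>lborel)"
  proof (rule nn_integral_mono_AE)
    \<comment> \<open>The origin must be excluded: there \<open>S_minus\<close> is \<open>0\<close> instead of \<open>-1\<close>.\<close>
    show "AE x in lborel. ennreal (norm (indicat_real {0..} x *\<^sub>R (1 + g x))) \<le> ennreal \<bar>g x - S_minus x\<bar>"
      using AE_lborel_singleton[of 0]
      by eventually_elim (auto simp: indicator_def S_minus_def sgn_if)
  qed
  also have "\<dots> < \<infinity>" using fin by (simp add: L1_norm_on_def)
  finally show "(\<integral>\<^sup>+ x. ennreal (norm (indicat_real {0..} x *\<^sub>R (1 + g x))) \<partial>lborel) < \<infinity>" .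
qed measurable

lemma shock_profile_L1_distance_infinite:
  assumes "shock_profile g"
  shows "L1_norm_on UNIV (\<lambda>x. g x - S_minus x) = \<infinity>"
proof (rule ccontr)
  assume "L1_norm_on UNIV (\<lambda>x. g x - S_minus x) \<noteq> \<infinity>"
  then have fin: "L1_norm_on UNIV (\<lambda>x. g x - S_minus x) < \<infinity>" by (simp add: top.not_eq_extremum)
  note g = assms[unfolded shock_profile_def]
  define d where "d z = deriv (\<lambda>y. g y * deriv g y) z" for z
  note an = real_analytic_deriv[of g] real_analytic_deriv[of "deriv g"] real_analytic_deriv[of "deriv (deriv g)"]
  have dg: "(g has_real_derivative deriv g z) (at z)"
    "(deriv g has_real_derivative deriv (deriv g) z) (at z)"
    "(deriv (deriv g) has_real_derivative deriv (deriv (deriv g)) z) (at z)" for z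
    using g an by blast+
  have flux: "((\<lambda>y. g y * deriv g y) has_real_derivative deriv g z * deriv g z + deriv (deriv g) z * g z) (at z)" for z
    by (rule DERIV_mult[OF dg(1,2)])
  \<comment> \<open>\<open>deriv\<close> is total, so the equation for \<open>deriv d\<close> becomes a derivative in the proper sense only
      once \<open>d\<close> is known to be differentiable.\<close>
  have d_eq: "d = (\<lambda>z. deriv g z * deriv g z + deriv (deriv g) z * g z)"
    unfolding d_def using DERIV_imp_deriv[OF flux] by blast
  have "d differentiable (at z)" for z
    unfolding d_eq real_differentiable_def 
    using DERIV_add[OF DERIV_mult[OF dg(2,2)] DERIV_mult[OF dg(3,1)]] by blast
  then have "(d has_real_derivative deriv d z) (at z)" for z
    using DERIV_deriv_iff_real_differentiable by blast
  moreover have "deriv d z = 1/3 * z * deriv g z" for z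
    using g unfolding d_def[abs_def] by blast
  ultimately have ode: "(d has_real_derivative 1/3 * z * deriv g z) (at z)" for z by metis
  have "continuous_on UNIV g"
    by (meson DERIV_isCont continuous_at_imp_continuous_on dg(1))
  then have "g \<in> borel_measurable borel" by (rule borel_measurable_continuous_onI)
  then interpret integrable_tail g "deriv g" d
    using g dg(1) flux ode fin 
    by unfold_locales (auto simp: d_eq intro: set_integrable_right_tail)
  obtain b where "\<forall>z\<ge>b. g z = - 1" using tail_eventually_constant by blast
  then have "g 0 = - 1" using real_analytic_const_of_ray[of g b "- 1"] g by blast
  with g show False by simp
qed

lemma odd_profile_bounded:
  fixes g :: "real \<Rightarrow> real"
  assumes cont: "continuous_on UNIV g" and odd: "\<And>z. g (- z) = - g z" and lim: "(g \<longlongrightarrow> - 1) at_top"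
  obtains B where "\<And>z. \<bar>g z\<bar> \<le> B"
proof -
  have "eventually (\<lambda>z. \<bar>g z\<bar> < 2) at_top"
    by (rule order_tendstoD(2)[OF tendsto_rabs[OF lim]]) simp
  then obtain b where b: "\<forall>z\<ge>b. \<bar>g z\<bar> < 2" unfolding eventually_at_top_linorder by blast
  have "compact (g ` {0..b})"
    by (intro compact_continuous_image continuous_on_subset[OF cont]) auto
  then obtain B where B: "\<forall>y\<in>g ` {0..b}. \<bar>y\<bar> \<le> B"
    using compact_imp_bounded bounded_real by metis
  have pos: "\<bar>g z\<bar> \<le> max 2 B" if "z \<ge> 0" for z
    using b B that by (cases "z \<ge> b") force+
  have "\<bar>g z\<bar> \<le> max 2 B" for z
    using pos[of z] pos[of "- z"] odd[of z] by (cases "z \<ge> 0") auto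
  then show thesis by (rule that)
qed

text \<open>For \<open>x \<noteq> 0\<close> the argument of \<open>g\<close> runs off to infinity, towards the limit that \<open>S_minus\<close>
  prescribes; the constant \<open>B + 1\<close> is an integrable majorant on a bounded interval.\<close>
lemma tendsto_L1_loc_S_minus:
  assumes cont: "continuous_on UNIV g" and odd: "\<And>z. g (- z) = - g z" and lim: "(g \<longlongrightarrow> - 1) at_top"
  shows "tendsto_L1_loc (u_minus g) S_minus (at_left 0)"
  unfolding tendsto_L1_loc_def tendsto_at_iff_sequentially
proof (intro allI impI)
  fix l :: real and X :: "nat \<Rightarrow> real"
  assume "l > 0" and X: "\<forall>i. X i \<in> {..<0} - {0}" "X \<longlonglongrightarrow> 0"
  obtain B where B: "\<And>z. \<bar>g z\<bar> \<le> B" using odd_profile_bounded[OF assms] by blast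
  define \<tau> where "\<tau> i = (- X i) powr (1/3)" for i
  have \<tau>: "\<tau> i > 0" for i using X(1)[rule_format, of i] by (simp add: \<tau>_def)
  have \<tau>_lim: "\<tau> \<longlonglongrightarrow> 0"
  proof -
    have "(\<lambda>i. (- X i) powr (1/3)) \<longlonglongrightarrow> (- 0) powr (1/3)"
      using X by (intro tendsto_powr' tendsto_minus tendsto_const) (auto intro!: always_eventually less_imp_le)
    then show ?thesis by (simp add: \<tau>_def[abs_def])
  qed
  have [measurable]: "g \<in> borel_measurable borel" using cont by (rule borel_measurable_continuous_onI)
  have [measurable]: "S_minus \<in> borel_measurable borel" unfolding S_minus_def[abs_def] by measurable
  have pos: "(\<lambda>i. g (x / \<tau> i)) \<longlonglongrightarrow> - 1" if "x > 0" for x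
  proof -
    have "filterlim (\<lambda>i. x / \<tau> i) at_top sequentially"
      by (rule LIM_at_top_divide[OF tendsto_const that \<tau>_lim]) (simp add: \<tau>)
    then show ?thesis by (rule filterlim_compose[OF lim])
  qed
  have neg: "(\<lambda>i. g (x / \<tau> i)) \<longlonglongrightarrow> 1" if "x < 0" for x
    using tendsto_minus[OF pos[of "- x"]] that by (simp add: odd)
  have "g 0 = 0" using odd[of 0] by simp
  then have conv: "(\<lambda>i. g (x / \<tau> i)) \<longlonglongrightarrow> S_minus x" for x
    using pos[of x] neg[of x] by (cases x "0 :: real" rule: linorder_cases) (auto simp: S_minus_def)
  have "(\<lambda>i. \<integral>\<^sup>+ x. ennreal \<bar>g (x / \<tau> i) - S_minus x\<bar> * indicator {- l..l} x \<partial>lborel)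
      \<longlonglongrightarrow> (\<integral>\<^sup>+ (x::real). 0 \<partial>lborel)"
  proof (rule nn_integral_dominated_convergence[where w = "\<lambda>x. ennreal (B + 1) * indicator {- l..l} x"])
    show "AE x in lborel. ennreal \<bar>g (x / \<tau> i) - S_minus x\<bar> * indicator {- l..l} x
        \<le> ennreal (B + 1) * indicator {- l..l} x" for i
    proof (intro AE_I2 mult_right_mono ennreal_leI)
      fix x
      have "\<bar>S_minus x\<bar> \<le> 1" by (simp add: S_minus_def sgn_if)
      then show "\<bar>g (x / \<tau> i) - S_minus x\<bar> \<le> B + 1" using B[of "x / \<tau> i"] by linarith
    qed simp
    show "(\<integral>\<^sup>+ x. ennreal (B + 1) * indicator {- l..l} x \<partial>lborel) < \<infinity>"
      using \<open>l > 0\<close> by (simp add: nn_integral_cmult_indicator ennreal_mult_less_top)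
    show "AE x in lborel. (\<lambda>i. ennreal \<bar>g (x / \<tau> i) - S_minus x\<bar> * indicator {- l..l} x) \<longlonglongrightarrow> 0"
    proof (rule AE_I2)
      fix x
      have "(\<lambda>i. ennreal \<bar>g (x / \<tau> i) - S_minus x\<bar>) \<longlonglongrightarrow> ennreal \<bar>S_minus x - S_minus x\<bar>"
        by (intro tendsto_ennrealI tendsto_rabs tendsto_diff conv tendsto_const)
      then show "(\<lambda>i. ennreal \<bar>g (x / \<tau> i) - S_minus x\<bar> * indicator {- l..l} x) \<longlonglongrightarrow> 0"
        by (cases "x \<in> {- l..l}") simp_all
    qed
  qed measurable
  then show "((\<lambda>t. L1_norm_on {- l..l} (\<lambda>x. u_minus g x t - S_minus x)) \<circ> X) \<longlonglongrightarrow> 0"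
    by (simp add: L1_norm_on_def u_minus_def \<tau>_def comp_def)
qed

theorem proposition3p2:
  fixes g :: "real \<Rightarrow> real"
  assumes "shock_profile g"
  shows "\<not> tendsto_L1 (u_minus g) S_minus (at_left 0) \<and>
    tendsto_L1_loc (u_minus g) S_minus (at_left 0)"
proof
  note g = assms[unfolded shock_profile_def]
  have cont: "continuous_on UNIV g"
    using g by (meson DERIV_isCont continuous_at_imp_continuous_on real_analytic_deriv(1))
  show "tendsto_L1_loc (u_minus g) S_minus (at_left 0)"
    using g by (intro tendsto_L1_loc_S_minus cont) auto
  show "\<not> tendsto_L1 (u_minus g) S_minus (at_left 0)"
  proof
    assume "tendsto_L1 (u_minus g) S_minus (at_left 0)"
    then have "eventually (\<lambda>t. L1_norm_on UNIV (\<lambda>x. u_minus g x t - S_minus x) < \<infinity>) (at_left 0)"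
      unfolding tendsto_L1_def by (rule order_tendstoD(2)) simp
    moreover have "eventually (\<lambda>t::real. t < 0) (at_left 0)"
      by (simp add: eventually_at_filter)
    ultimately have "eventually (\<lambda>t::real. False) (at_left 0)"
    proof eventually_elim
      case (elim t)
      then show ?case
        using L1_norm_on_UNIV_rescale[OF borel_measurable_continuous_onI[OF cont], of t]
          shock_profile_L1_distance_infinite[OF assms]
        by (simp add: ennreal_mult_top)
    qed
    then show False by simp
  qed
qed

end
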